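(* For every even positive integer $N$ there exists a $5$-pile Candy Nim game $G$ that is a $\mathcal{P}$ position (piles may be empty) with $N(G) = N$ and $N_W(G) \leq \frac{3}{2}\sqrt{2N} - 2$.
   Context: Candy Nim is played with the positions and moves of Nim: a position (game) $[a_1,\dots,a_p]$ consists of $p$ piles with $a_i \ge 0$ candies, and in a move a player removes a positive number of candies from one pile. Players alternate; the player taking the last candy wins. A position is a $\mathcal{P}$ position if the bitwise XOR (nim-sum) $a_1\oplus\cdots\oplus a_p$ is $0$ (the player to move loses the underlying Nim game), and an $\mathcal{N}$ position otherwise. The losing player is called Luca and the winning player Windsor: in a $\mathcal{P}$ position it is Luca's turn, in an $\mathcal{N}$ position it is Windsor's turn. Luca may make any move; Windsor is forced to make winning Nim moves, i.e. each of his moves must lead to a $\mathcal{P}$ position. Subject to this, each player tries to collect as many candies as possible. For a position $G$, $N(G)$ is the total number of candies, and $N_L(G)$ and $N_W(G)$ are the numbers of candies collected by Luca and Windsor under optimal play (minimax). *)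

theory Defs
  imports Complex_Main
begin

unbundle bit_operations_syntax

text \<open>A position of Nim is the list of its pile sizes; empty piles are allowed.\<close>

type_synonym position = "nat list"

definition nim_sum :: "position \<Rightarrow> nat" where
  "nim_sum G = foldr (XOR) G 0"

definition P_position :: "position \<Rightarrow> bool" where
  "P_position G \<longleftrightarrow> nim_sum G = 0"

text \<open>The pair \<open>(i, k)\<close> is the move that removes \<open>k\<close> candies from pile \<open>i\<close>.\<close>

definition moves :: "position \<Rightarrow> (nat \<times> nat) set" where
  "moves G = {(i, k). i < length G \<and> 0 < k \<and> k \<le> G ! i}"

definition play :: "position \<Rightarrow> nat \<times> nat \<Rightarrow> position" where
  "play G m = G[fst m := G ! fst m - snd m]"

definition winning_moves :: "position \<Rightarrow> (nat \<times> nat) set" where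
  "winning_moves G = {m \<in> moves G. P_position (play G m)}"

definition candies :: "position \<Rightarrow> nat" where
  "candies G = sum_list G"

lemma finite_moves: "finite (moves G)"
proof -
  have "moves G \<subseteq> (SIGMA i:{..<length G}. {..G ! i})"
    by (auto simp: moves_def)
  then show ?thesis
    by (rule finite_subset) auto
qed

lemma candies_play: "m \<in> moves G \<Longrightarrow> candies (play G m) + snd m = candies G"
  using member_le_sum_list[of "G ! fst m" G]
  by (auto simp: moves_def play_def candies_def sum_list_update)

lemma candies_play_less: "m \<in> moves G \<Longrightarrow> candies (play G m) < candies G"
  using candies_play[of m G] by (auto simp: moves_def)

lemma moves_nonempty:
  assumes "\<not> P_position G \<or> candies G > 0"
  shows "moves G \<noteq> {}"
proof
  assume "moves G = {}"
  then have "a = 0" if "a \<in> set G" for a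
    using that by (fastforce simp: moves_def in_set_conv_nth)
  then have "nim_sum G = 0 \<and> sum_list G = 0"
    by (induction G) (auto simp: nim_sum_def)
  then show False
    using assms by (metis P_position_def candies_def less_irrefl)
qed

lemma nim_sum_update:
  "i < length G \<Longrightarrow> nim_sum (G[i := t]) = nim_sum G XOR (G ! i XOR t)"
proof (induction G arbitrary: i)
  case (Cons a G)
  show ?case
  proof (cases i)
    case 0
    have "t XOR nim_sum G = (a XOR nim_sum G) XOR (a XOR t)"
      by (rule bit_eqI) (auto simp only: bit_xor_iff)
    with 0 show ?thesis
      by (simp only: nim_sum_def list_update_code nth_Cons_0 foldr_Cons o_apply)
  next
    case (Suc j)
    then have "nim_sum (G[j := t]) = nim_sum G XOR (G ! j XOR t)"
      using Cons by simp
    with Suc show ?thesis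
      by (simp only: nim_sum_def list_update_code nth_Cons_Suc foldr_Cons o_apply xor.assoc)
  qed
qed simp

lemma bit_nim_sumD: "bit (nim_sum G) n \<Longrightarrow> \<exists>i<length G. bit (G ! i) n"
proof -
  have "bit (nim_sum G) n \<Longrightarrow> \<exists>a\<in>set G. bit a n"
    by (induction G) (auto simp: nim_sum_def bit_xor_iff)
  then show "bit (nim_sum G) n \<Longrightarrow> ?thesis"
    by (metis in_set_conv_nth)
qed

lemma winning_moves_nonempty:
  assumes "\<not> P_position G"
  shows "winning_moves G \<noteq> {}"
proof -
  define x where "x = nim_sum G"
  have "x > 0"
    using assms by (simp add: x_def P_position_def)
  then obtain n where n: "2 ^ n \<le> x" "x < 2 ^ (n + 1)"
    using ex_power_ivl1[of 2 x] by auto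
  have x1: "drop_bit n x = 1"
    using n by (simp add: drop_bit_eq_div div_nat_eqI)
  then have "bit x n"
    by (simp add: bit_iff_odd_drop_bit)
  then obtain i where i: "i < length G" "bit (G ! i) n"
    using bit_nim_sumD x_def by blast
  define t where "t = G ! i XOR x"
  have "drop_bit n t = drop_bit n (G ! i) XOR 1"
    by (simp add: t_def x1)
  moreover have "odd (drop_bit n (G ! i))"
    using i(2) by (simp add: bit_iff_odd_drop_bit)
  ultimately have "drop_bit n t < drop_bit n (G ! i)"
    by (auto simp: xor_Suc_0_eq elim: oddE)
  then have t: "t < G ! i"
    unfolding drop_bit_eq_div using div_le_mono leD not_le_imp_less by metis
  have "nim_sum (G[i := t]) = 0"
    using i(1) unfolding nim_sum_update[OF i(1)] t_def x_def
    by (intro bit_eqI) (auto simp: bit_simps)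
  then have "(i, G ! i - t) \<in> winning_moves G"
    using i t by (auto simp: winning_moves_def moves_def play_def P_position_def)
  then show ?thesis
    by blast
qed

text \<open>
  The candies collected by Windsor (\<open>N_W\<close>) and by Luca (\<open>N_L\<close>) under optimal play, by backward
  induction. The position determines who is to move: Luca in a \<open>\<P>\<close> position, Windsor (who may only
  use winning moves) otherwise. As \<open>N_L G + N_W G\<close> is the total number of candies (lemma
  \<open>N_L_plus_N_W\<close> below), Luca maximises \<open>N_L\<close> by minimising \<open>N_W\<close>, and vice versa for Windsor.
  The sets under \<open>Min\<close> and \<open>Max\<close> are finite, and nonempty by \<open>moves_nonempty\<close> and
  \<open>winning_moves_nonempty\<close>.
\<close>

function N_W :: "position \<Rightarrow> nat" where
  "N_W G =
    (if moves G = {} then 0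
     else if P_position G then Min ((\<lambda>m. N_W (play G m)) ` moves G)
     else Max ((\<lambda>m. snd m + N_W (play G m)) ` winning_moves G))"
  by pat_completeness auto
termination
  by (relation "measure candies") (auto simp: winning_moves_def intro: candies_play_less)

function N_L :: "position \<Rightarrow> nat" where
  "N_L G =
    (if moves G = {} then 0
     else if P_position G then Max ((\<lambda>m. snd m + N_L (play G m)) ` moves G)
     else Min ((\<lambda>m. N_L (play G m)) ` winning_moves G))"
  by pat_completeness auto
termination
  by (relation "measure candies") (auto simp: winning_moves_def intro: candies_play_less)

declare N_W.simps [simp del] N_L.simps [simp del]

lemma Min_plus_Max_const:
  fixes f g :: "'a \<Rightarrow> nat"
  assumes "finite A" "A \<noteq> {}" "\<And>a. a \<in> A \<Longrightarrow> f a + g a = c"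
  shows "Min (f ` A) + Max (g ` A) = c"
proof -
  have "Min (f ` A) \<in> f ` A"
    using assms(1,2) by (intro Min_in) simp_all
  then obtain a where a: "a \<in> A" "Min (f ` A) = f a"
    by (rule imageE)
  have "Max (g ` A) = g a"
  proof (rule Max_eqI)
    fix y assume "y \<in> g ` A"
    then obtain b where b: "b \<in> A" "y = g b"
      by auto
    have "f a \<le> f b"
      using a b assms by (metis Min_le finite_imageI imageI)
    then show "y \<le> g a"
      using assms(3)[OF a(1)] assms(3)[OF b(1)] b by linarith
  qed (use a assms in auto)
  then show ?thesis
    using a assms by simp
qed

lemma N_L_plus_N_W: "N_L G + N_W G = candies G"
proof (induction G rule: measure_induct_rule[of candies])
  case (less G)
  then have IH: "N_L (play G m) + N_W (play G m) + snd m = candies G" if "m \<in> moves G" for m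
    using that candies_play candies_play_less by metis
  have sub: "winning_moves G \<subseteq> moves G"
    by (auto simp: winning_moves_def)
  consider "moves G = {}" | "moves G \<noteq> {}" "P_position G" | "moves G \<noteq> {}" "\<not> P_position G"
    by blast
  then show ?case
  proof cases
    case 1
    then have "candies G = 0"
      using moves_nonempty[of G] by blast
    with 1 show ?thesis
      by (simp add: N_L.simps[of G] N_W.simps[of G])
  next
    case 2
    have "Min ((\<lambda>m. N_W (play G m)) ` moves G)
        + Max ((\<lambda>m. snd m + N_L (play G m)) ` moves G) = candies G"
      using 2 IH by (intro Min_plus_Max_const finite_moves) (auto simp: algebra_simps)
    with 2 show ?thesis
      by (simp add: N_L.simps[of G] N_W.simps[of G])
  next
    case 3
    have "Min ((\<lambda>m. N_L (play G m)) ` winning_moves G)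
        + Max ((\<lambda>m. snd m + N_W (play G m)) ` winning_moves G) = candies G"
      using 3 IH sub finite_subset[OF sub finite_moves] winning_moves_nonempty
      by (intro Min_plus_Max_const) (auto simp: algebra_simps subset_iff)
    with 3 show ?thesis
      by (simp add: N_L.simps[of G] N_W.simps[of G])
  qed
qed

end

theory Submission
  imports Defs
begin

text \<open>
  Write \<open>n = N / 2\<close>, let \<open>B = 2 ^ m\<close> be the power of two with \<open>B\<^sup>2 \<le> n + 1 < 4 * B\<^sup>2\<close>, and divide with
  remainder: \<open>n + 1 = (A + 1) * B + u\<close>. The game is \<open>[A * B, A * B + (B - 1), B - 1, u, u]\<close>.

  Call the first two piles the large ones: they have the same digits above position \<open>m\<close>, while below
  it one has only zeros and the other only ones. Luca reduces the latter from \<open>A * B + (B - 1)\<close> to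
  \<open>(A - 1) * B\<close>, for a gain of \<open>2 * B - 1\<close>. Only the other large pile can restore the nim-sum \<open>0\<close>, and
  it has to become \<open>(A - 1) * B + (B - 1)\<close>, so Windsor gets a single candy. The large piles have
  exchanged their roles and \<open>A\<close> has dropped by one (lemma \<open>N_W_two_large_piles\<close>). After \<open>A\<close> such
  rounds, all piles are smaller than \<open>B\<close>; from then on Luca always takes a largest pile, which
  leaves Windsor at most half of the rest (lemma \<open>N_W_le_half\<close>), that is \<open>B - 1 + u\<close>.

  Windsor thus collects at most \<open>A + B - 1 + u\<close> candies. With \<open>A + 1 = a * B\<close> and \<open>u\<close> close to \<open>B\<close> this
  is about \<open>(a + 2) * B\<close>, to be compared with \<open>3 * sqrt n\<close>, about \<open>3 * sqrt a * B\<close>; and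
  \<open>a + 2 \<le> 3 * sqrt a\<close> holds exactly when \<open>1 \<le> a \<le> 4\<close>, which is why \<open>B\<close> is chosen as above.
\<close>

section \<open>Bounding Windsor's share by a strategy of Luca\<close>

lemma finite_winning_moves: "finite (winning_moves G)"
  by (rule finite_subset[OF _ finite_moves[of G]]) (auto simp: winning_moves_def)

lemma nim_sum_play:
  assumes "m \<in> moves G"
  shows "nim_sum (play G m) = nim_sum G XOR (G ! fst m XOR (G ! fst m - snd m))"
  using assms by (auto simp: moves_def play_def nim_sum_update)

lemma xor_eq_0_iff_nat: "a XOR b = 0 \<longleftrightarrow> a = b" for a b :: nat
proof
  assume "a XOR b = 0"
  then have "a XOR (a XOR b) = a"
    by simp
  then show "a = b"
    by (simp flip: xor.assoc)
qed simp

lemma not_P_position_play: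
  assumes "P_position G" "m \<in> moves G"
  shows "\<not> P_position (play G m)"
  using assms by (auto simp: P_position_def nim_sum_play xor_eq_0_iff_nat moves_def)

text \<open>
  In a \<open>\<P>\<close> position Luca minimises \<open>N_W\<close>, so each of his moves gives an upper bound, once all
  answers of Windsor are examined.
\<close>

lemma N_W_leI:
  assumes P: "P_position G" and m: "m \<in> moves G"
    and answers: "\<And>m'. m' \<in> winning_moves (play G m)
      \<Longrightarrow> snd m' + N_W (play (play G m) m') \<le> c"
  shows "N_W G \<le> c"
proof -
  let ?H = "play G m"
  have "N_W G = Min ((\<lambda>m. N_W (play G m)) ` moves G)"
    using P m by (subst N_W.simps) auto
  also have "\<dots> \<le> N_W ?H"
    using m by (intro Min_le finite_imageI finite_moves) auto
  also have "N_W ?H \<le> c"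
  proof (cases "moves ?H = {}")
    case True
    then show ?thesis by (simp add: N_W.simps[of ?H])
  next
    case False
    have nP: "\<not> P_position ?H"
      using P m by (rule not_P_position_play)
    have "N_W ?H = Max ((\<lambda>m'. snd m' + N_W (play ?H m')) ` winning_moves ?H)"
      using False nP by (subst N_W.simps) simp
    also have "\<dots> \<le> c"
      using winning_moves_nonempty[OF nP] answers
      by (subst Max_le_iff) (auto intro: finite_winning_moves)
    finally show ?thesis .
  qed
  finally show ?thesis .
qed

text \<open>
  Luca gets at least as much as Windsor in every \<open>\<P>\<close> position: he takes a whole largest pile, and no
  answer can remove more than that.
\<close>

lemma N_W_le_half:
  assumes "P_position G"
  shows "2 * N_W G \<le> candies G"
  using assms
proof (induction G rule: measure_induct_rule[of candies])
  case (less G)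
  show ?case
  proof (cases "moves G = {}")
    case True
    then show ?thesis by (simp add: N_W.simps[of G])
  next
    case False
    then obtain i0 where i0: "i0 < length G" "0 < G ! i0"
      by (auto simp: moves_def)
    have ne: "set G \<noteq> {}"
      using i0 by auto
    define x where "x = Max (set G)"
    have max: "a \<le> x" if "a \<in> set G" for a
      using that by (simp add: x_def)
    have "x \<in> set G"
      unfolding x_def using ne by (intro Max_in) auto
    then obtain i where i: "i < length G" "G ! i = x"
      by (auto simp: in_set_conv_nth)
    have "0 < x"
      using max[of "G ! i0"] i0 by auto
    then have m: "(i, x) \<in> moves G"
      using i by (auto simp: moves_def)
    let ?H = "play G (i, x)"
    have "N_W G \<le> candies G div 2"
    proof (rule N_W_leI[OF less.prems m])
      fix m' assume w: "m' \<in> winning_moves ?H"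
      then have m': "m' \<in> moves ?H" and P: "P_position (play ?H m')"
        by (auto simp: winning_moves_def)
      have less': "candies (play ?H m') < candies G"
        using candies_play_less[OF m] candies_play_less[OF m'] by simp
      have "snd m' \<le> ?H ! fst m'" "fst m' < length G"
        using m' by (auto simp: moves_def play_def)
      moreover have "?H ! fst m' \<le> x"
        using \<open>fst m' < length G\<close> i max by (auto simp: play_def nth_list_update)
      ultimately have "snd m' \<le> x"
        by simp
      then show "snd m' + N_W (play ?H m') \<le> candies G div 2"
        using less.IH[OF less' P] candies_play[OF m] candies_play[OF m'] by simp
    qed
    then show ?thesis by simp
  qed
qed

section \<open>Two large piles that agree in their high digits\<close>

lemma xor_eq_add:
  assumes "l < 2 ^ m"
  shows "(a * 2 ^ m) XOR l = a * 2 ^ m + (l :: nat)"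
proof -
  have "take_bit m l = l"
    using assms by (simp add: take_bit_nat_eq_self)
  then have "\<not> bit l k" if "k \<ge> m" for k
    using that by (metis bit_take_bit_iff leD)
  then have "(a * 2 ^ m) AND l = 0"
    by (intro bit_eqI) (auto simp: bit_simps simp flip: push_bit_eq_mult)
  then show ?thesis
    by (simp add: disjunctive_add_eq_xor)
qed

text \<open>
  Luca lowers the pile \<open>j\<close> to \<open>(A - 1) * 2 ^ m\<close>. This changes the nim-sum at a position \<open>\<ge> m\<close>, where the
  small piles have no digits, and undoing the move itself would mean adding candies; so Windsor has
  to answer in the pile \<open>i\<close>, and he gets a single candy there. The argument then repeats with \<open>i\<close> and
  \<open>j\<close> interchanged.

  In the bound for \<open>N_W G\<close>, the summand \<open>A\<close> counts Windsor's single candies in these rounds, and the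
  rest is half of the \<open>candies G - 2 * A * 2 ^ m\<close> candies that are then left.
\<close>

lemma N_W_two_large_piles:
  assumes "P_position G" "i < length G" "j < length G" "i \<noteq> j"
    and "G ! i = A * 2 ^ m" "G ! j = A * 2 ^ m + (2 ^ m - 1)"
    and "\<And>k. k < length G \<Longrightarrow> k \<noteq> i \<Longrightarrow> k \<noteq> j \<Longrightarrow> G ! k < 2 ^ m"
  shows "2 * N_W G + 2 * (A * 2 ^ m) \<le> candies G + 2 * A"
  using assms
proof (induction A arbitrary: G i j)
  case 0
  then show ?case
    using N_W_le_half[of G] by simp
next
  case (Suc A)
  note P = Suc.prems(1) and ij = Suc.prems(2-4) and Gi = Suc.prems(5) and Gj = Suc.prems(6)
    and small = Suc.prems(7)
  define B :: nat where "B = 2 ^ m"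
  have B: "B > 0"
    by (simp add: B_def)
  have xorB: "(a * B) XOR (B - 1) = a * B + (B - 1)" for a
    unfolding B_def by (rule xor_eq_add) simp
  define mv where "mv = (j, 2 * B - 1)"
  have mv: "mv \<in> moves G"
    using ij Gj B by (auto simp: mv_def moves_def simp flip: B_def)
  have "G ! j - (2 * B - 1) = A * B"
    using Gj B by (simp flip: B_def)
  then have H: "play G mv = G[j := A * B]"
    by (simp add: play_def mv_def)
  define d where "d = (Suc A * B + (B - 1)) XOR A * B"
  have sumH: "nim_sum (G[j := A * B]) = d"
    using P ij Gj by (simp add: nim_sum_update P_position_def d_def B_def)
  have d_high: "drop_bit m d = Suc A XOR A"
  proof -
    have "drop_bit m (a * B + r) = a" if "r < B" for a r
      using that by (simp add: drop_bit_eq_div flip: B_def)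
    from this[of "B - 1" "Suc A"] this[of 0 A] show ?thesis
      using B by (simp only: d_def drop_bit_xor) simp
  qed
  have "N_W G \<le> (candies G + 2 * Suc A - 2 * (Suc A * B)) div 2"
  proof (rule N_W_leI[OF P mv])
    fix m' assume "m' \<in> winning_moves (play G mv)"
    then have w: "m' \<in> winning_moves (G[j := A * B])"
      by (simp only: H)
    obtain k t where m'_eq: "m' = (k, t)"
      by (cases m')
    define old where "old = G[j := A * B] ! k"
    define new where "new = old - t"
    have k: "k < length G" and t: "0 < t" "t \<le> old"
      using w by (auto simp: winning_moves_def moves_def m'_eq old_def)
    have pos: "play (G[j := A * B]) m' = G[j := A * B, k := new]"
      by (simp add: play_def m'_eq new_def old_def)
    have Pnew: "P_position (G[j := A * B, k := new])"
      using w pos by (simp add: winning_moves_def)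
    then have "d XOR (old XOR new) = 0"
      using k nim_sum_update[of k "G[j := A * B]" new] sumH by (simp add: P_position_def old_def)
    then have "new = old XOR d"
      by (metis xor.left_commute xor_eq_0_iff_nat xor_self_eq xor.right_neutral)
    have new_less: "new < old"
      using t by (simp add: new_def)
    have k_eq: "k = i"
    proof (rule ccontr)
      assume "k \<noteq> i"
      show False
      proof (cases "k = j")
        case True
        then have "old = A * B"
          using ij by (simp add: old_def)
        then have "new = Suc A * B + (B - 1)"
          using \<open>new = old XOR d\<close>
          by (simp only: d_def xor.left_commute[of "A * B"] xor_self_eq xor.right_neutral)
        then show False
          using new_less \<open>old = A * B\<close> by simp
      next
        case False
        then have "old < 2 ^ m"
          using small k \<open>k \<noteq> i\<close> by (simp add: old_def)
        then have "drop_bit m old = 0" "drop_bit m new = 0"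
          using new_less by (simp_all add: drop_bit_eq_div)
        then have "drop_bit m d = 0"
          using \<open>new = old XOR d\<close> by simp
        then show False
          using d_high by (simp add: xor_eq_0_iff_nat)
      qed
    qed
    then have old_eq: "old = Suc A * B"
      using ij Gi by (simp add: old_def B_def)
    have "new = A * B + (B - 1)"
    proof -
      have "new = (Suc A * B) XOR ((Suc A * B XOR (B - 1)) XOR A * B)"
        using \<open>new = old XOR d\<close> old_eq d_def xorB[of "Suc A"] by simp
      also have "\<dots> = A * B XOR (B - 1)"
        by (simp only: xor.assoc[symmetric] xor_self_eq xor.left_neutral) (simp add: xor.commute)
      finally show ?thesis
        using xorB by simp
    qed
    then have "t = 1"
      using new_def old_eq t B by simp
    let ?K = "G[j := A * B, i := A * B + (B - 1)]"
    have K: "play (play G mv) m' = ?K"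
      using pos k_eq \<open>new = A * B + (B - 1)\<close> H by simp
    have "2 * N_W ?K + 2 * (A * 2 ^ m) \<le> candies ?K + 2 * A"
    proof (rule Suc.IH[of ?K j i])
      show "P_position ?K"
        using Pnew k_eq \<open>new = A * B + (B - 1)\<close> by simp
    qed (use ij small in \<open>auto simp: B_def\<close>)
    moreover have "candies ?K + 2 * B = candies G"
    proof -
      have "candies (play (play G mv) m') + snd m' = candies (play G mv)"
        using w H by (intro candies_play) (simp add: winning_moves_def)
      then show ?thesis
        using candies_play[OF mv] K \<open>t = 1\<close> m'_eq mv_def B by simp
    qed
    ultimately show "snd m' + N_W (play (play G mv) m')
        \<le> (candies G + 2 * Suc A - 2 * (Suc A * B)) div 2"
      using K \<open>t = 1\<close> m'_eq by (simp add: B_def)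
  qed
  moreover have "G ! i + G ! j \<le> candies G"
  proof -
    have "(\<Sum>k\<in>{i, j}. G ! k) \<le> (\<Sum>k<length G. G ! k)"
      using ij by (intro sum_mono2) auto
    then show ?thesis
      using ij by (simp add: candies_def sum_list_sum_nth atLeast0LessThan)
  qed
  ultimately show ?case
    using Gi Gj by (simp add: B_def)
qed

section \<open>The game with five piles\<close>

lemma five_pile_P_position:
  fixes A u m :: nat
  assumes "u < 2 ^ m"
  defines "B \<equiv> 2 ^ m :: nat"
  defines "G \<equiv> [A * B, A * B + (B - 1), B - 1, u, u]"
  shows "P_position G" and "candies G = 2 * (A * B + (B - 1) + u)"
    and "N_W G \<le> A + (B - 1) + u"
proof -
  have "A * B + (B - 1) = (A * B) XOR (B - 1)"
    unfolding B_def by (rule xor_eq_add[symmetric]) simp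
  moreover have "x XOR (x XOR y) = y" for x y :: nat
    by (simp flip: xor.assoc)
  ultimately show P: "P_position G"
    by (simp only: P_position_def nim_sum_def G_def foldr_Cons foldr_Nil o_apply id_apply xor.assoc
        xor_self_eq xor.right_neutral)
  show sum: "candies G = 2 * (A * B + (B - 1) + u)"
    by (simp add: candies_def G_def)
  have "2 * N_W G + 2 * (A * 2 ^ m) \<le> candies G + 2 * A"
  proof (rule N_W_two_large_piles[of G 0 1])
    show "G ! k < 2 ^ m" if "k < length G" "k \<noteq> 0" "k \<noteq> 1" for k
      using that assms(1) by (auto simp: G_def B_def nth_Cons' less_Suc_eq)
  qed (use P in \<open>auto simp: G_def B_def\<close>)
  then show "N_W G \<le> A + (B - 1) + u"
    unfolding sum B_def[symmetric] by simp
qed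

text \<open>
  The right-hand side minus the left-hand side is concave in \<open>u\<close> and in \<open>a\<close>, so it is enough that it
  is nonnegative at the four corners of the rectangle \<open>0 \<le> u \<le> b - 1\<close>, \<open>b \<le> a \<le> 4 * b - 1\<close>. The
  identities in the proof split off the product of the distances to the two ends of an interval, by
  which a quadratic with leading coefficient \<open>-1\<close> exceeds its chord.
\<close>

lemma square_sum_le:
  fixes a b u :: real
  assumes b: "b \<ge> 2" and a: "b \<le> a" "a \<le> 4 * b - 1" and u: "0 \<le> u" "u \<le> b - 1"
  shows "(a + b + u)\<^sup>2 \<le> 9 * (a * b + u - 1)"
proof -
  define f where "f x = 9 * (a * b + x - 1) - (a + b + x)\<^sup>2" for x
  have corner: "0 \<le> (a - b) * (4 * b - 1 - a)"
    using a by simp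
  have sq: "4 \<le> b * b"
    using mult_mono[OF b b] b by simp
  have "f 0 = (a - b) * (4 * b - 1 - a) + (a - b) * (2 * b + 1) + (5 * (b * b) - 9)"
    by (simp add: f_def power2_eq_square algebra_simps)
  then have f0: "0 \<le> f 0"
    using corner sq a b by (smt (verit) mult_nonneg_nonneg)
  have "f (b - 1) = (a - b) * (4 * b - 1 - a) + 3 * (a - b) + (15 * b - 19)"
    by (simp add: f_def power2_eq_square algebra_simps)
  then have f1: "0 \<le> f (b - 1)"
    using corner a b by (simp only:) (intro add_nonneg_nonneg; simp)
  have "(b - 1) * f u = (b - 1 - u) * f 0 + u * f (b - 1) + (b - 1) * (u * (b - 1 - u))"
    by (simp add: f_def power2_eq_square algebra_simps)
  also have "\<dots> \<ge> 0"
    using f0 f1 u b by (intro add_nonneg_nonneg mult_nonneg_nonneg) auto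
  finally have "0 \<le> f u"
    using b by (simp add: zero_le_mult_iff)
  then show ?thesis
    by (simp add: f_def)
qed

theorem theorem6p8:
  fixes N :: nat
  assumes "even N" and "N > 0"
  shows "\<exists>G :: position. length G = 5 \<and> P_position G \<and> candies G = N
           \<and> real (N_W G) \<le> 3 / 2 * sqrt (2 * real N) - 2"
proof -
  define n where "n = N div 2"
  have N: "N = 2 * n" and n: "n > 0"
    using assms by (auto simp: n_def elim: evenE)
  obtain m where m: "4 ^ m \<le> n + 1" "n + 1 < 4 ^ (m + 1)"
    using ex_power_ivl1[of 4 "n + 1"] by auto
  define B :: nat where "B = 2 ^ m"
  have B: "B > 0" and BB: "4 ^ m = B * B"
    by (simp_all add: B_def flip: power_mult_distrib)
  define A' where "A' = (n + 1) div B"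
  define u where "u = (n + 1) mod B"
  have n_eq: "n + 1 = A' * B + u" and u: "u < B"
    using B by (simp_all add: A'_def u_def)
  have A'_ge: "B \<le> A'"
    using m(1) B by (simp add: A'_def BB less_eq_div_iff_mult_less_eq)
  have A'_less: "A' < 4 * B"
    using m(2) B unfolding A'_def by (intro less_mult_imp_div_less) (simp add: BB)
  define A where "A = A' - 1"
  have A': "A' = A + 1"
    using A'_ge B by (simp add: A_def)
  define G where "G = [A * B, A * B + (B - 1), B - 1, u, u]"
  have game: "P_position G" "candies G = 2 * (A * B + (B - 1) + u)" "N_W G \<le> A + (B - 1) + u"
    unfolding G_def B_def using u by (intro five_pile_P_position; simp add: B_def)+
  have cand: "candies G = N"
    using game(2) n_eq B by (simp add: N A')
  have n_real: "real n = real A' * real B + real u - 1"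
    using arg_cong[OF n_eq, of real] by simp
  have "(real A' + real B + real u)\<^sup>2 \<le> 9 * (real A' * real B + real u - 1)"
  proof (cases "B = 1")
    \<comment> \<open>For \<open>B = 1\<close> the corner \<open>A' = B\<close>, \<open>u = 0\<close> violates the inequality; it is the excluded \<open>n = 0\<close>.\<close>
    case True
    then have "A' = 2 \<or> A' = 3"
      using A'_less n_eq n u by auto
    then show ?thesis
      using True u by auto
  next
    case False
    then show ?thesis
      using A'_ge A'_less u B by (intro square_sum_le) auto
  qed
  then have "(real A' + real B + real u)\<^sup>2 \<le> 9 * real n"
    by (simp add: n_real)
  then have "real A' + real B + real u \<le> sqrt (9 * real n)"
    by (rule real_le_rsqrt)
  also have "\<dots> = 3 / 2 * sqrt (2 * real N)"
    by (simp add: N real_sqrt_mult)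
  finally have "real (A + (B - 1) + u) \<le> 3 / 2 * sqrt (2 * real N) - 2"
    using B by (simp add: A' of_nat_diff)
  then have "real (N_W G) \<le> 3 / 2 * sqrt (2 * real N) - 2"
    using game(3) by linarith
  moreover have "length G = 5"
    by (simp add: G_def)
  ultimately show ?thesis
    using game(1) cand by blast
qed

end
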